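(* Let $(X,G)$ be a complete $G$-metric space, let $p\ge 1$ be an integer, and let $A_1,\dots,A_p$ be non-empty closed subsets of $X$, with the convention $A_{p+1}=A_1$. Let $T:\bigcup_{i=1}^{p}A_i\to\bigcup_{i=1}^{p}A_i$ be a cyclical operator, i.e. $T(A_i)\subseteq A_{i+1}$ for all $i\in\{1,\dots,p\}$. Let $\phi:[0,\infty)\to[0,\infty)$ be an altering distance function and let $\psi:[0,\infty)^3\to[0,\infty)$ be a continuous function such that $\psi(x,y,z)=0$ if and only if $x=y=z=0$. Suppose that $T$ is at least one of the following. (1) A $G$-cyclic $(\phi-\psi)$-Kannan type contraction: there exist real constants $\alpha,\beta$ such that, with $\gamma=2\beta$, one has $0\le\gamma<1$ and $0<\alpha+\gamma\le 1$, and for every $i\in\{1,\dots,p\}$ and all $x\in A_i$, $y,z\in A_{i+1}$, $$\phi\big(G(Tx,Ty,Tz)\big)\le \phi\Big(\alpha G(x,Tx,Tx)+\beta\big(G(y,Ty,Ty)+G(z,Tz,Tz)\big)\Big)-\psi\big(G(x,Tx,Tx),G(y,Ty,Ty),G(z,Tz,Tz)\big).$$ (2) A $G$-cyclic $(\phi-\psi)$-Chatterjea type contraction: there exist real constants $\alpha,\beta$ with $0\le\alpha\le\frac12$ and $0<\alpha+\beta\le 1$ such that for every $i\in\{1,\dots,p\}$ and all $x\in A_i$, $y,z\in A_{i+1}$, $$\phi\big(G(Tx,Ty,Tz)\big)\le \phi\big(\alpha G(x,Ty,Tz)+\beta G(y,z,Tx)\big)-\psi\big(G(x,Ty,Tz),G(y,z,Tx),G(z,y,Tx)\big).$$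 Then $T$ has a unique fixed point $u$, and $u\in\bigcap_{i=1}^{p}A_i$.
   Context: A $G$-metric on a non-empty set $X$ is a function $G:X\times X\times X\to[0,\infty)$ such that: (G1) $G(x,y,z)=0$ if $x=y=z$; (G2) $0<G(x,x,y)$ whenever $x\ne y$; (G3) $G(x,x,y)\le G(x,y,z)$ for all $x,y,z$ with $y\neq z$; (G4) $G$ is symmetric in all three variables; (G5) $G(x,y,z)\le G(x,a,a)+G(a,y,z)$ for all $x,y,z,a\in X$. The pair $(X,G)$ is then a $G$-metric space. A sequence $\{x_n\}$ is $G$-convergent to $x$ if $\lim_{n,m\to\infty}G(x,x_n,x_m)=0$, and it is $G$-Cauchy if $\lim_{n,m,\ell\to\infty}G(x_n,x_m,x_\ell)=0$. The space is complete if every $G$-Cauchy sequence in $X$ is $G$-convergent in $X$. A subset is closed if it contains the limits of all $G$-convergent sequences of its elements. An altering distance function is a function $\phi:[0,\infty)\to[0,\infty)$ that is continuous, nondecreasing, and satisfies $\phi(t)=0$ if and only if $t=0$. Since $\phi$ is defined only on $[0,\infty)$, each contractive inequality is understood to include the requirement that the argument of $\phi$ on its right-hand side be nonnegative. *)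

theory Defs
  imports Complex_Main
begin

locale G_metric_space =
  fixes X :: "'a set" and G :: "'a \<Rightarrow> 'a \<Rightarrow> 'a \<Rightarrow> real"
  assumes nonempty: "X \<noteq> {}"
    and nonneg: "\<lbrakk>x \<in> X; y \<in> X; z \<in> X\<rbrakk> \<Longrightarrow> 0 \<le> G x y z"
    and G1: "x \<in> X \<Longrightarrow> G x x x = 0"
    and G2: "\<lbrakk>x \<in> X; y \<in> X; x \<noteq> y\<rbrakk> \<Longrightarrow> 0 < G x x y"
    and G3: "\<lbrakk>x \<in> X; y \<in> X; z \<in> X; y \<noteq> z\<rbrakk> \<Longrightarrow> G x x y \<le> G x y z"
    and G4: "\<lbrakk>x \<in> X; y \<in> X; z \<in> X\<rbrakk> \<Longrightarrow>
       G x y z = G x z y \<and> G x y z = G y x z \<and> G x y z = G y z x \<and>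
       G x y z = G z x y \<and> G x y z = G z y x"
    and G5: "\<lbrakk>x \<in> X; y \<in> X; z \<in> X; a \<in> X\<rbrakk> \<Longrightarrow> G x y z \<le> G x a a + G a y z"

text \<open>Multi-index limits are joint limits, the indices tending to infinity independently.\<close>

definition G_convergent_to ::
    "'a set \<Rightarrow> ('a \<Rightarrow> 'a \<Rightarrow> 'a \<Rightarrow> real) \<Rightarrow> (nat \<Rightarrow> 'a) \<Rightarrow> 'a \<Rightarrow> bool" where
  "G_convergent_to X G s x \<longleftrightarrow> range s \<subseteq> X \<and> x \<in> X \<and>
     ((\<lambda>(n, m). G x (s n) (s m)) \<longlongrightarrow> 0) (sequentially \<times>\<^sub>F sequentially)"

definition G_Cauchy ::
    "'a set \<Rightarrow> ('a \<Rightarrow> 'a \<Rightarrow> 'a \<Rightarrow> real) \<Rightarrow> (nat \<Rightarrow> 'a) \<Rightarrow> bool" where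
  "G_Cauchy X G s \<longleftrightarrow> range s \<subseteq> X \<and>
     ((\<lambda>(n, m, l). G (s n) (s m) (s l)) \<longlongrightarrow> 0)
       (sequentially \<times>\<^sub>F sequentially \<times>\<^sub>F sequentially)"

definition G_complete :: "'a set \<Rightarrow> ('a \<Rightarrow> 'a \<Rightarrow> 'a \<Rightarrow> real) \<Rightarrow> bool" where
  "G_complete X G \<longleftrightarrow> (\<forall>s. G_Cauchy X G s \<longrightarrow> (\<exists>x. G_convergent_to X G s x))"

definition G_closed :: "'a set \<Rightarrow> ('a \<Rightarrow> 'a \<Rightarrow> 'a \<Rightarrow> real) \<Rightarrow> 'a set \<Rightarrow> bool" where
  "G_closed X G S \<longleftrightarrow> S \<subseteq> X \<and>
     (\<forall>s x. range s \<subseteq> S \<longrightarrow> G_convergent_to X G s x \<longrightarrow> x \<in> S)"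

text \<open>Functions on $[0,\infty)$ and $[0,\infty)^3$ are represented by functions on the whole type
  that are constrained, and used, only at nonnegative arguments.\<close>

definition altering_distance :: "(real \<Rightarrow> real) \<Rightarrow> bool" where
  "altering_distance \<phi> \<longleftrightarrow>
     \<phi> ` {0..} \<subseteq> {0..} \<and> continuous_on {0..} \<phi> \<and> mono_on {0..} \<phi> \<and>
     (\<forall>t\<ge>0. \<phi> t = 0 \<longleftrightarrow> t = 0)"

definition psi_function :: "(real \<Rightarrow> real \<Rightarrow> real \<Rightarrow> real) \<Rightarrow> bool" where
  "psi_function \<psi> \<longleftrightarrow>
     (\<forall>x\<ge>0. \<forall>y\<ge>0. \<forall>z\<ge>0. 0 \<le> \<psi> x y z) \<and>
     continuous_on ({0..} \<times> {0..} \<times> {0..}) (\<lambda>(x, y, z). \<psi> x y z) \<and>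
     (\<forall>x\<ge>0. \<forall>y\<ge>0. \<forall>z\<ge>0. \<psi> x y z = 0 \<longleftrightarrow> x = 0 \<and> y = 0 \<and> z = 0)"

text \<open>The sets are $A_1,\dots,A_p$; the convention $A_{p+1} = A_1$ is part of the definition.\<close>

definition cyclical_operator :: "nat \<Rightarrow> (nat \<Rightarrow> 'a set) \<Rightarrow> ('a \<Rightarrow> 'a) \<Rightarrow> bool" where
  "cyclical_operator p A T \<longleftrightarrow>
     A (p + 1) = A 1 \<and>
     T ` (\<Union>i\<in>{1..p}. A i) \<subseteq> (\<Union>i\<in>{1..p}. A i) \<and>
     (\<forall>i\<in>{1..p}. T ` A i \<subseteq> A (i + 1))"

text \<open>Some of the coefficients below may be negative, so the contractive inequalities explicitly
  require the argument of \<open>\<phi>\<close> on the right-hand side to be nonnegative.\<close>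

definition G_cyclic_Kannan ::
    "('a \<Rightarrow> 'a \<Rightarrow> 'a \<Rightarrow> real) \<Rightarrow> nat \<Rightarrow> (nat \<Rightarrow> 'a set) \<Rightarrow> (real \<Rightarrow> real) \<Rightarrow>
     (real \<Rightarrow> real \<Rightarrow> real \<Rightarrow> real) \<Rightarrow> ('a \<Rightarrow> 'a) \<Rightarrow> bool" where
  "G_cyclic_Kannan G p A \<phi> \<psi> T \<longleftrightarrow>
     (\<exists>\<alpha> \<beta> \<gamma>. \<gamma> = 2 * \<beta> \<and> 0 \<le> \<gamma> \<and> \<gamma> < 1 \<and> 0 < \<alpha> + \<gamma> \<and> \<alpha> + \<gamma> \<le> 1 \<and>
       (\<forall>i\<in>{1..p}. \<forall>x\<in>A i. \<forall>y\<in>A (i + 1). \<forall>z\<in>A (i + 1).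
          0 \<le> \<alpha> * G x (T x) (T x) + \<beta> * (G y (T y) (T y) + G z (T z) (T z)) \<and>
          \<phi> (G (T x) (T y) (T z))
            \<le> \<phi> (\<alpha> * G x (T x) (T x) + \<beta> * (G y (T y) (T y) + G z (T z) (T z)))
              - \<psi> (G x (T x) (T x)) (G y (T y) (T y)) (G z (T z) (T z))))"

definition G_cyclic_Chatterjea ::
    "('a \<Rightarrow> 'a \<Rightarrow> 'a \<Rightarrow> real) \<Rightarrow> nat \<Rightarrow> (nat \<Rightarrow> 'a set) \<Rightarrow> (real \<Rightarrow> real) \<Rightarrow>
     (real \<Rightarrow> real \<Rightarrow> real \<Rightarrow> real) \<Rightarrow> ('a \<Rightarrow> 'a) \<Rightarrow> bool" where
  "G_cyclic_Chatterjea G p A \<phi> \<psi> T \<longleftrightarrow>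
     (\<exists>\<alpha> \<beta>. 0 \<le> \<alpha> \<and> \<alpha> \<le> 1 / 2 \<and> 0 < \<alpha> + \<beta> \<and> \<alpha> + \<beta> \<le> 1 \<and>
       (\<forall>i\<in>{1..p}. \<forall>x\<in>A i. \<forall>y\<in>A (i + 1). \<forall>z\<in>A (i + 1).
          0 \<le> \<alpha> * G x (T y) (T z) + \<beta> * G y z (T x) \<and>
          \<phi> (G (T x) (T y) (T z))
            \<le> \<phi> (\<alpha> * G x (T y) (T z) + \<beta> * G y z (T x))
              - \<psi> (G x (T y) (T z)) (G y z (T x)) (G z y (T x))))"

end

theory Submission
  imports Defs
begin

text \<open>Everything is expressed through the quasi-metric \<open>d x y = G x y y\<close>, which satisfies the
  triangle inequality and \<open>d y x \<le> 2 d x y\<close>. Along an orbit of \<open>T\<close> the contractive inequality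
  makes the consecutive distances decrease, and passing to the limit in it forces \<open>\<psi>\<close> to vanish
  there, so these distances tend to 0. If the orbit were not Cauchy, a minimality argument along
  pairs of indices \<open>(n, n + 1 + j p)\<close>, which lie in consecutive sets of the cycle, would produce
  distances tending to some \<open>\<epsilon> > 0\<close>, and the limit of the inequality would again force
  \<open>\<epsilon> = 0\<close>. The orbit visits each of the closed sets infinitely often, so its limit lies in all
  of them, and one more limit of the inequality shows that it is fixed.\<close>

section \<open>Altering distance functions\<close>

text \<open>By continuity the inequality survives in the limit; \<open>b' \<le> a'\<close> and
  monotonicity give \<open>\<phi> b' \<le> \<phi> a'\<close>, which leaves
  \<open>\<psi> s' t' w' \<le> 0\<close>.\<close>

lemma altering_psi_limit:
  fixes a b s t w :: "nat \<Rightarrow> real"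
  assumes \<phi>: "altering_distance \<phi>" and \<psi>: "psi_function \<psi>"
    and lim: "a \<longlonglongrightarrow> a'" "b \<longlonglongrightarrow> b'" "s \<longlonglongrightarrow> s'" "t \<longlonglongrightarrow> t'" "w \<longlonglongrightarrow> w'"
    and nonneg: "\<And>n. 0 \<le> a n" "\<And>n. 0 \<le> b n" "\<And>n. 0 \<le> s n" "\<And>n. 0 \<le> t n" "\<And>n. 0 \<le> w n"
    and ineq: "\<And>n. \<phi> (a n) \<le> \<phi> (b n) - \<psi> (s n) (t n) (w n)"
    and "b' \<le> a'"
  shows "s' = 0 \<and> t' = 0 \<and> w' = 0"
proof -
  have ge: "0 \<le> a'" "0 \<le> b'" "0 \<le> s'" "0 \<le> t'" "0 \<le> w'"
    using lim nonneg by (auto intro: LIMSEQ_le_const)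
  have cont: "continuous_on {0..} \<phi>" "mono_on {0..} \<phi>"
    "continuous_on ({0..} \<times> {0..} \<times> {0..}) (\<lambda>(x, y, z). \<psi> x y z)"
    using \<phi> \<psi> by (auto simp: altering_distance_def psi_function_def)
  have 1: "(\<lambda>n. \<phi> (a n)) \<longlonglongrightarrow> \<phi> a'"
    by (rule continuous_on_tendsto_compose[OF cont(1) lim(1)]) (use ge nonneg in auto)
  have 2: "(\<lambda>n. \<phi> (b n)) \<longlonglongrightarrow> \<phi> b'"
    by (rule continuous_on_tendsto_compose[OF cont(1) lim(2)]) (use ge nonneg in auto)
  have "(\<lambda>n. (\<lambda>(x, y, z). \<psi> x y z) (s n, t n, w n)) \<longlonglongrightarrow> (\<lambda>(x, y, z). \<psi> x y z) (s', t', w')"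
    by (rule continuous_on_tendsto_compose[OF cont(3)])
       (use ge nonneg lim in \<open>auto intro!: tendsto_Pair\<close>)
  then have 3: "(\<lambda>n. \<psi> (s n) (t n) (w n)) \<longlonglongrightarrow> \<psi> s' t' w'"
    by simp
  have "\<phi> a' \<le> \<phi> b' - \<psi> s' t' w'"
    using LIMSEQ_le[OF 1 tendsto_diff[OF 2 3]] ineq by blast
  moreover have "\<phi> b' \<le> \<phi> a'"
    using cont(2) \<open>b' \<le> a'\<close> ge by (auto intro: mono_onD)
  moreover have "0 \<le> \<psi> s' t' w'" "\<psi> s' t' w' = 0 \<longleftrightarrow> s' = 0 \<and> t' = 0 \<and> w' = 0"
    using \<psi> ge by (auto simp: psi_function_def)
  ultimately show ?thesis by linarith
qed

text \<open>Constant sequences in the limit lemma; this form compares consecutive steps and gives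
  uniqueness in the Chatterjea case.\<close>

lemma altering_psi_le:
  assumes "altering_distance \<phi>" "psi_function \<psi>"
    and "0 \<le> a" "0 \<le> b" "0 \<le> s" "0 \<le> t" "0 \<le> w"
    and "\<phi> a \<le> \<phi> b - \<psi> s t w" "b \<le> a"
  shows "s = 0 \<and> t = 0 \<and> w = 0"
  by (rule altering_psi_limit[where a = "\<lambda>_. a" and b = "\<lambda>_. b" and s = "\<lambda>_. s"
        and t = "\<lambda>_. t" and w = "\<lambda>_. w"
        and a' = a and b' = b, OF assms(1,2)]) (use assms in auto)

text \<open>Continuity at 0 together with \<open>\<phi> 0 = 0 < \<phi> \<epsilon>\<close>. Since
  \<phi> need not be strictly increasing, a strict gap between values has to be produced this
  way.\<close>

lemma altering_distance_exists_smaller: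
  assumes "altering_distance \<phi>" "0 < \<epsilon>"
  shows "\<exists>\<eta>>0. \<phi> \<eta> < \<phi> \<epsilon>"
proof -
  have cont: "continuous_on {0..} \<phi>"
    using assms by (simp add: altering_distance_def)
  have "\<phi> 0 = 0" "0 \<le> \<phi> \<epsilon>" "\<phi> \<epsilon> \<noteq> 0"
    using assms by (auto simp: altering_distance_def image_subset_iff)
  then have pos: "\<phi> 0 < \<phi> \<epsilon>"
    by linarith
  have "(\<lambda>n. \<phi> (inverse (real (Suc n)))) \<longlonglongrightarrow> \<phi> 0"
    by (rule continuous_on_tendsto_compose[OF cont LIMSEQ_inverse_real_of_nat]) auto
  then have "\<forall>\<^sub>F n in sequentially. \<phi> (inverse (real (Suc n))) < \<phi> \<epsilon>"
    using pos by (rule order_tendstoD)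
  then obtain n where "\<phi> (inverse (real (Suc n))) < \<phi> \<epsilon>"
    by (auto simp: eventually_sequentially)
  then show ?thesis by (intro exI[of _ "inverse (real (Suc n))"]) simp
qed

section \<open>The quasi-metric of a G-metric space\<close>

context G_metric_space
begin

abbreviation d :: "'a \<Rightarrow> 'a \<Rightarrow> real" where
  "d x y \<equiv> G x y y"

lemma d_nonneg: "x \<in> X \<Longrightarrow> y \<in> X \<Longrightarrow> 0 \<le> d x y"
  by (rule nonneg)

lemma d_triangle: "x \<in> X \<Longrightarrow> y \<in> X \<Longrightarrow> z \<in> X \<Longrightarrow> d x z \<le> d x y + d y z"
  by (rule G5)

lemma G_diag_left: "x \<in> X \<Longrightarrow> y \<in> X \<Longrightarrow> G y y x = d x y"
  using G4[of y y x] by blast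

lemma d_eq_0_iff:
  assumes "x \<in> X" "y \<in> X"
  shows "d x y = 0 \<longleftrightarrow> x = y"
proof (cases "x = y")
  case True
  then show ?thesis using G1 assms by simp
next
  case False
  then show ?thesis using G2[of y x] G_diag_left[of x y] assms by simp
qed

text \<open>\<open>G5\<close> through the point \<open>y\<close> bounds \<open>G x x y\<close>,
  which is \<open>d y x\<close>, by two terms that both equal \<open>d x y\<close>.\<close>

lemma d_commute_le:
  assumes "x \<in> X" "y \<in> X"
  shows "d y x \<le> 2 * d x y"
proof -
  have "G y x y = d x y"
    using G4[of y x y] assms by blast
  moreover have "G x x y = d y x"
    using assms by (rule G_diag_left[rotated])
  ultimately show ?thesis using G5[of x x y y] assms by linarith
qed

text \<open>\<open>G5\<close> through the middle argument \<open>x\<close>; this reduces three-point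
  values to the quasi-metric.\<close>

lemma G_le_d: "x \<in> X \<Longrightarrow> y \<in> X \<Longrightarrow> z \<in> X \<Longrightarrow> G y x z \<le> d y x + d z x"
  using G5[of y x z x] G_diag_left[of z x] by simp

text \<open>One of the two triangle inequalities yields \<open>d y x\<close> instead of
  \<open>d x y\<close>; the factor 2 pays for reversing it.\<close>

lemma d_diff_left: "x \<in> X \<Longrightarrow> y \<in> X \<Longrightarrow> v \<in> X \<Longrightarrow> \<bar>d x v - d y v\<bar> \<le> 2 * d x y"
  using d_triangle[of x y v] d_triangle[of y x v] d_commute_le[of x y] d_nonneg[of x y]
  by linarith

lemma d_diff_right: "x \<in> X \<Longrightarrow> y \<in> X \<Longrightarrow> v \<in> X \<Longrightarrow> \<bar>d v x - d v y\<bar> \<le> 2 * d x y"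
  using d_triangle[of v x y] d_triangle[of v y x] d_commute_le[of x y] d_nonneg[of x y]
  by linarith

text \<open>Forward, the joint limit is restricted to the diagonal and the distance reversed at the
  cost of a factor 2. Backward, \<open>G_le_d\<close> splits \<open>G\<close> at the limit point
  into two terms, each depending on one index.\<close>

lemma G_convergent_to_iff:
  assumes s: "range s \<subseteq> X" and x: "x \<in> X"
  shows "G_convergent_to X G s x \<longleftrightarrow> (\<lambda>n. d (s n) x) \<longlonglongrightarrow> 0"
proof
  have sX: "s n \<in> X" for n using s by auto
  {
    assume "G_convergent_to X G s x"
    then have "((\<lambda>(n, m). G x (s n) (s m)) \<longlongrightarrow> 0) (sequentially \<times>\<^sub>F sequentially)"
      by (simp add: G_convergent_to_def)
    moreover have "filterlim (\<lambda>n. (n, n)) (sequentially \<times>\<^sub>F sequentially) sequentially"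
      by (intro filterlim_Pair filterlim_ident)
    ultimately have "(\<lambda>n. (case (n, n) of (n, m) \<Rightarrow> G x (s n) (s m))) \<longlonglongrightarrow> 0"
      by (rule filterlim_compose)
    then have "(\<lambda>n. 2 * d x (s n)) \<longlonglongrightarrow> 0"
      by (auto intro: tendsto_mult_right_zero)
    then show "(\<lambda>n. d (s n) x) \<longlonglongrightarrow> 0"
      by (rule tendsto_0_le[where K = 1])
         (use sX x in \<open>auto intro!: always_eventually simp: d_commute_le d_nonneg\<close>)
  next
    assume lim: "(\<lambda>n. d (s n) x) \<longlonglongrightarrow> 0"
    have proj: "filterlim fst sequentially (sequentially \<times>\<^sub>F sequentially)"
      "filterlim snd sequentially (sequentially \<times>\<^sub>F sequentially)"
      by (simp_all add: filterlim_def filtermap_fst_prod_filter filtermap_snd_prod_filter)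
    have "((\<lambda>q. d (s (fst q)) x + d (s (snd q)) x) \<longlongrightarrow> 0 + 0)
        (sequentially \<times>\<^sub>F sequentially)"
      by (intro tendsto_add filterlim_compose[OF lim proj(1)]
          filterlim_compose[OF lim proj(2)])
    moreover have "\<forall>\<^sub>F q in sequentially \<times>\<^sub>F sequentially.
        norm (case q of (n, m) \<Rightarrow> G x (s n) (s m))
          \<le> norm (d (s (fst q)) x + d (s (snd q)) x) * 1"
    proof (intro always_eventually allI, clarify)
      fix n m
      have "G x (s n) (s m) = G (s n) x (s m)" using G4 sX x by blast
      then show "norm (G x (s n) (s m)) \<le> norm (d (s (fst (n, m))) x + d (s (snd (n, m))) x) * 1"
        using G_le_d[of x "s n" "s m"] sX x nonneg by simp
    qed
    ultimately have "((\<lambda>(n, m). G x (s n) (s m)) \<longlongrightarrow> 0) (sequentially \<times>\<^sub>F sequentially)"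
      by (simp only: add_0_left) (rule tendsto_0_le)
    then show "G_convergent_to X G s x"
      using s x by (simp add: G_convergent_to_def)
  }
qed

text \<open>Two indices suffice, because \<open>G_le_d\<close> bounds the three-index value by two
  distances, each below \<epsilon> / 2.\<close>

lemma G_CauchyI:
  assumes s: "range s \<subseteq> X"
    and small: "\<And>\<epsilon>. 0 < \<epsilon> \<Longrightarrow> \<exists>N. \<forall>n\<ge>N. \<forall>m\<ge>N. d (s n) (s m) < \<epsilon>"
  shows "G_Cauchy X G s"
  unfolding G_Cauchy_def
proof (intro conjI s tendstoI)
  fix \<epsilon> :: real assume "0 < \<epsilon>"
  then obtain N where N: "\<And>n m. n \<ge> N \<Longrightarrow> m \<ge> N \<Longrightarrow> d (s n) (s m) < \<epsilon> / 2"
    using small[of "\<epsilon> / 2"] by auto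
  have sX: "s n \<in> X" for n using s by auto
  have "G (s n) (s m) (s l) < \<epsilon>" if "n \<ge> N" "m \<ge> N" "l \<ge> N" for n m l
    using G_le_d[of "s m" "s n" "s l"] N[of n m] N[of l m] that sX by simp
  then have "dist (G (s n) (s m) (s l)) 0 < \<epsilon>" if "n \<ge> N" "m \<ge> N" "l \<ge> N" for n m l
    using that nonneg sX by simp
  then show "\<forall>\<^sub>F q in sequentially \<times>\<^sub>F sequentially \<times>\<^sub>F sequentially.
      dist (case q of (n, m, l) \<Rightarrow> G (s n) (s m) (s l)) 0 < \<epsilon>"
    unfolding eventually_prod_filter
    by (intro exI[of _ "\<lambda>n. n \<ge> N"] exI[of _ "\<lambda>(m, l). m \<ge> N \<and> l \<ge> N"]
        conjI eventually_ge_at_top) auto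
qed

end

section \<open>Orbits of cyclic maps\<close>

text \<open>The cycle of sets is unrolled to a \<open>p\<close>-periodic sequence \<open>B\<close>.\<close>

locale cyclic_orbit = G_metric_space X G
  for X :: "'a set" and G :: "'a \<Rightarrow> 'a \<Rightarrow> 'a \<Rightarrow> real" +
  fixes p :: nat and B :: "nat \<Rightarrow> 'a set" and T :: "'a \<Rightarrow> 'a" and x\<^sub>0 :: 'a
    and \<phi> :: "real \<Rightarrow> real" and \<psi> :: "real \<Rightarrow> real \<Rightarrow> real \<Rightarrow> real"
  assumes complete: "G_complete X G"
    and p_pos: "0 < p"
    and B_closed: "G_closed X G (B n)"
    and B_periodic: "B (n + p) = B n"
    and T_B: "x \<in> B n \<Longrightarrow> T x \<in> B (Suc n)"
    and x\<^sub>0: "x\<^sub>0 \<in> B 0"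
    and altering: "altering_distance \<phi>" and psi: "psi_function \<psi>"
begin

definition s :: "nat \<Rightarrow> 'a" where
  "s n = (T ^^ n) x\<^sub>0"

lemma T_s: "T (s n) = s (Suc n)"
  by (simp add: s_def)

lemma B_sub: "x \<in> B n \<Longrightarrow> x \<in> X"
  using B_closed by (auto simp: G_closed_def)

lemma s_B: "s n \<in> B n"
  by (induction n) (use x\<^sub>0 T_B in \<open>auto simp: s_def\<close>)

lemma s_X [simp]: "s n \<in> X"
  using s_B B_sub by blast

lemma B_periodic_mult: "B (n + j * p) = B n"
proof (induction j)
  case (Suc j)
  have "B (n + Suc j * p) = B (n + j * p + p)" by (simp add: algebra_simps)
  then show ?case using Suc B_periodic by metis
qed simp

lemma d_s_nonneg: "0 \<le> d (s n) (s m)"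
  by (simp add: d_nonneg)

text \<open>Padding the sum to \<open>p\<close> terms makes the bound independent of
  \<open>k\<close>, so one null sequence controls all jumps of length at most
  \<open>p\<close>.\<close>

lemma d_s_le_sum:
  assumes "k \<le> p"
  shows "d (s n) (s (n + k)) \<le> (\<Sum>i<p. d (s (n + i)) (s (Suc (n + i))))"
proof -
  have "d (s n) (s (n + k)) \<le> (\<Sum>i<k. d (s (n + i)) (s (Suc (n + i))))"
  proof (induction k)
    case 0
    show ?case by (simp add: G1)
  next
    case (Suc k)
    then show ?case using d_triangle[of "s n" "s (n + k)" "s (Suc (n + k))"] by simp
  qed
  also have "\<dots> \<le> (\<Sum>i<p. d (s (n + i)) (s (Suc (n + i))))"
    by (rule sum_mono2) (use assms d_s_nonneg in auto)
  finally show ?thesis .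
qed

lemma sum_steps_tendsto_0:
  assumes "(\<lambda>n. d (s n) (s (Suc n))) \<longlonglongrightarrow> 0"
  shows "(\<lambda>n. \<Sum>i<p. d (s (n + i)) (s (Suc (n + i)))) \<longlonglongrightarrow> 0"
proof -
  have "(\<lambda>n. \<Sum>i<p. d (s (n + i)) (s (Suc (n + i)))) \<longlonglongrightarrow> (\<Sum>i<p. 0)"
    by (intro tendsto_sum LIMSEQ_ignore_initial_segment[OF assms])
  then show ?thesis by simp
qed

text \<open>\<open>small\<close> only treats index gaps congruent to 1 modulo \<open>p\<close>, the
  pairs to which the contraction applies. Any later index reaches such a gap within \<open>p\<close>
  further steps, and these are short.\<close>

lemma orbit_limit:
  assumes steps: "(\<lambda>n. d (s n) (s (Suc n))) \<longlonglongrightarrow> 0"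
    and small: "\<And>\<epsilon>. 0 < \<epsilon> \<Longrightarrow> \<exists>N. \<forall>n\<ge>N. \<forall>j. d (s n) (s (n + 1 + j * p)) < \<epsilon>"
  obtains u where "(\<lambda>n. d (s n) u) \<longlonglongrightarrow> 0" "\<And>n. u \<in> B n"
proof -
  have "G_Cauchy X G s"
  proof (rule G_CauchyI)
    show "range s \<subseteq> X" by auto
    fix \<epsilon> :: real assume "0 < \<epsilon>"
    \<comment> \<open>The budget is \<epsilon> / 6 for the gap plus twice \<epsilon> / 6 for the
      reversed jump, hence \<epsilon> / 2; swapping the order of the indices doubles this to
      \<epsilon>.\<close>
    then obtain N1 where N1: "\<And>n j. n \<ge> N1 \<Longrightarrow> d (s n) (s (n + 1 + j * p)) < \<epsilon> / 6"
      using small[of "\<epsilon> / 6"] by auto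
    have "\<forall>\<^sub>F n in sequentially. (\<Sum>i<p. d (s (n + i)) (s (Suc (n + i)))) < \<epsilon> / 6"
      by (rule order_tendstoD[OF sum_steps_tendsto_0[OF steps]]) (use \<open>0 < \<epsilon>\<close> in simp)
    then obtain N2 where N2: "\<And>n. n \<ge> N2 \<Longrightarrow> (\<Sum>i<p. d (s (n + i)) (s (Suc (n + i)))) < \<epsilon> / 6"
      by (auto simp: eventually_sequentially)
    have le: "d (s n) (s m) < \<epsilon> / 2" if "max N1 N2 \<le> n" "n \<le> m" for n m
    proof -
      have "\<exists>k\<le>p. \<exists>j. m + k = n + 1 + j * p"
      \<comment> \<open>The case \<open>m = n\<close> is separate because truncated subtraction
        would falsify \<open>m = n + 1 + q\<close>; there \<open>k = 1\<close> and
        \<open>j = 0\<close> work.\<close>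
      proof (cases "m = n")
        case True
        then show ?thesis using p_pos by (intro exI[of _ 1]) auto
      next
        case False
        define q where "q = m - n - 1"
        have "q mod p < p" "q div p * p + q mod p = q" using p_pos by auto
        moreover have "m = n + 1 + q" using that False by (simp add: q_def)
        moreover have "(q div p + 1) * p = q div p * p + p" by simp
        ultimately have "m + (p - q mod p) = n + 1 + (q div p + 1) * p"
          by linarith
        then show ?thesis by (metis diff_le_self)
      qed
      then obtain k j where k: "k \<le> p" "m + k = n + 1 + j * p" by blast
      \<comment> \<open>The path overshoots to \<open>s (m + k)\<close> and comes back, against the
        direction in which the steps are measured.\<close>
      have "d (s (m + k)) (s m) \<le> 2 * d (s m) (s (m + k))"
        by (rule d_commute_le) auto
      also have "d (s m) (s (m + k)) < \<epsilon> / 6"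
        using d_s_le_sum[OF k(1), of m] N2[of m] that by simp
      finally show ?thesis
        using d_triangle[of "s n" "s (m + k)" "s m"] N1[of n j] that k(2) by simp
    qed
    have "d (s n) (s m) < \<epsilon>" if "max N1 N2 \<le> n" "max N1 N2 \<le> m" for n m
    proof (cases "n \<le> m")
      case True
      then show ?thesis using le[of n m] that \<open>0 < \<epsilon>\<close> by simp
    next
      case False
      then show ?thesis using le[of m n] that d_commute_le[of "s m" "s n"] by simp
    qed
    then show "\<exists>N. \<forall>n\<ge>N. \<forall>m\<ge>N. d (s n) (s m) < \<epsilon>" by blast
  qed
  then obtain u where conv: "G_convergent_to X G s u"
    using complete by (auto simp: G_complete_def)
  then have u: "u \<in> X" by (simp add: G_convergent_to_def)
  have lim: "(\<lambda>n. d (s n) u) \<longlonglongrightarrow> 0"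
    using conv G_convergent_to_iff[of s u] u by (simp add: image_subset_iff)
  moreover have "u \<in> B n" for n
  proof -
    \<comment> \<open>The visits at times congruent to \<open>n\<close> modulo \<open>p\<close> all
      lie in the closed set \<open>B n\<close>.\<close>
    define r where "r k = s (n + k * p)" for k
    have "strict_mono (\<lambda>k. n + k * p)"
      using p_pos by (auto simp: strict_mono_def)
    from LIMSEQ_subseq_LIMSEQ[OF lim this] have "(\<lambda>k. d (r k) u) \<longlonglongrightarrow> 0"
      by (simp add: o_def r_def)
    moreover have rB: "r k \<in> B n" for k
      using s_B[of "n + k * p"] by (simp add: r_def B_periodic_mult)
    ultimately have "G_convergent_to X G r u"
      using G_convergent_to_iff[of r u] u B_sub by auto
    with rB show ?thesis using B_closed[of n] by (auto simp: G_closed_def)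
  qed
  ultimately show ?thesis using that by blast
qed

lemma d_orbit_tendsto:
  assumes lim: "(\<lambda>n. d (s n) u) \<longlonglongrightarrow> 0" and X: "u \<in> X" "v \<in> X"
  shows "(\<lambda>n. d (s n) v) \<longlonglongrightarrow> d u v"
proof -
  have "(\<lambda>n. d (s n) v - d u v) \<longlonglongrightarrow> 0"
    by (rule tendsto_0_le[OF lim, where K = 2])
       (use X d_diff_left[of "s _" u v] d_nonneg[of "s _" u] in \<open>auto simp: mult.commute\<close>)
  then show ?thesis by (simp add: LIM_zero_iff)
qed

lemma decreasing_steps_tendsto:
  assumes "\<And>n. d (s (Suc n)) (s (Suc (Suc n))) \<le> d (s n) (s (Suc n))"
  obtains r where "(\<lambda>n. d (s n) (s (Suc n))) \<longlonglongrightarrow> r"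
proof -
  have "decseq (\<lambda>n. d (s n) (s (Suc n)))"
    using assms by (rule decseq_SucI)
  then show ?thesis
    by (rule decseq_convergent[where B = 0]) (auto simp: d_s_nonneg intro: that)
qed

section \<open>Kannan type contractions\<close>

context
  fixes \<alpha> \<gamma> :: real
  assumes coeff: "0 \<le> \<gamma>" "\<gamma> < 1" "\<alpha> + \<gamma> \<le> 1"
    and kannan: "\<And>n x y. x \<in> B n \<Longrightarrow> y \<in> B (Suc n) \<Longrightarrow>
        0 \<le> \<alpha> * d x (T x) + \<gamma> * d y (T y) \<and>
        \<phi> (d (T x) (T y))
          \<le> \<phi> (\<alpha> * d x (T x) + \<gamma> * d y (T y)) - \<psi> (d x (T x)) (d y (T y)) (d y (T y))"
begin

lemma kannan_step:
  assumes "s m \<in> B (Suc n)"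
  shows "0 \<le> \<alpha> * d (s n) (s (Suc n)) + \<gamma> * d (s m) (s (Suc m))"
    and "\<phi> (d (s (Suc n)) (s (Suc m)))
      \<le> \<phi> (\<alpha> * d (s n) (s (Suc n)) + \<gamma> * d (s m) (s (Suc m)))
        - \<psi> (d (s n) (s (Suc n))) (d (s m) (s (Suc m))) (d (s m) (s (Suc m)))"
  using kannan[OF s_B[of n] assms] by (simp_all add: T_s)

text \<open>An increasing step would dominate the argument of \<phi> on the right, so \<psi> would
  vanish and the step be 0. The limit \<open>r\<close> of the decreasing steps satisfies
  \<open>\<alpha> * r + \<gamma> * r \<le> r\<close>, and the same argument gives
  \<open>r = 0\<close>.\<close>

lemma kannan_steps_tendsto_0: "(\<lambda>n. d (s n) (s (Suc n))) \<longlonglongrightarrow> 0"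
proof -
  let ?\<delta> = "\<lambda>n. d (s n) (s (Suc n))"
  note step = kannan_step[OF s_B]
  have "?\<delta> (Suc n) \<le> ?\<delta> n" for n
  proof (rule ccontr)
    assume "\<not> ?thesis"
    then have less: "?\<delta> n < ?\<delta> (Suc n)" by simp
    \<comment> \<open>As \<alpha> may be negative, it is first replaced by its upper bound
      \<open>1 - \<gamma>\<close>, which is nonnegative.\<close>
    have "\<alpha> * ?\<delta> n \<le> (1 - \<gamma>) * ?\<delta> n"
      by (rule mult_right_mono) (use coeff d_s_nonneg in auto)
    also have "\<dots> \<le> (1 - \<gamma>) * ?\<delta> (Suc n)"
      by (rule mult_left_mono) (use coeff less in auto)
    finally have "\<alpha> * ?\<delta> n + \<gamma> * ?\<delta> (Suc n) \<le> ?\<delta> (Suc n)"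
      by (simp add: algebra_simps)
    with altering_psi_le[OF altering psi _ step(1) _ _ _ step(2)[of n]] less
    show False by (simp add: d_s_nonneg)
  qed
  then obtain r where r: "?\<delta> \<longlonglongrightarrow> r"
    by (rule decreasing_steps_tendsto)
  then have r': "(\<lambda>n. ?\<delta> (Suc n)) \<longlonglongrightarrow> r"
    by (rule LIMSEQ_Suc)
  have "0 \<le> r"
    using r d_s_nonneg by (auto intro: LIMSEQ_le_const)
  have lim: "(\<lambda>n. \<alpha> * ?\<delta> n + \<gamma> * ?\<delta> (Suc n)) \<longlonglongrightarrow> \<alpha> * r + \<gamma> * r"
    by (intro tendsto_intros r r')
  have "\<alpha> * r + \<gamma> * r \<le> r"
    using mult_right_mono[OF coeff(3) \<open>0 \<le> r\<close>] by (simp add: algebra_simps)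
  then have "r = 0"
    using altering_psi_limit[OF altering psi r' lim r r' r' _ step(1) _ _ _ step(2)]
    by (simp add: d_s_nonneg)
  with r show ?thesis by simp
qed

text \<open>The right-hand side contains only consecutive distances, which tend to 0, so it bounds
  all far distances uniformly in \<open>j\<close>.\<close>

lemma kannan_small:
  assumes "0 < \<epsilon>"
  shows "\<exists>N. \<forall>n\<ge>N. \<forall>j. d (s n) (s (n + 1 + j * p)) < \<epsilon>"
proof -
  obtain \<eta> where \<eta>: "0 < \<eta>" "\<phi> \<eta> < \<phi> \<epsilon>"
    using altering_distance_exists_smaller[OF altering assms] by blast
  have mono: "\<phi> a \<le> \<phi> b" if "0 \<le> a" "a \<le> b" for a b
    using altering that by (auto simp: altering_distance_def intro: mono_onD)
  have "\<forall>\<^sub>F n in sequentially. d (s n) (s (Suc n)) < \<eta> / 2"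
    \<comment> \<open>Both coefficients are at most 1, so two steps below \<eta> / 2 keep the
      argument of \<phi> below \<eta>.\<close>
    by (rule order_tendstoD[OF kannan_steps_tendsto_0]) (use \<eta> in simp)
  then obtain N where N: "\<And>n. n \<ge> N \<Longrightarrow> d (s n) (s (Suc n)) < \<eta> / 2"
    by (auto simp: eventually_sequentially)
  have "d (s (Suc n)) (s (Suc n + 1 + j * p)) < \<epsilon>" if "n \<ge> N" for n j
  proof (rule ccontr)
    define m where "m = n + 1 + j * p"
    let ?b = "\<alpha> * d (s n) (s (Suc n)) + \<gamma> * d (s m) (s (Suc m))"
    have m: "s m \<in> B (Suc n)"
      using s_B[of m] B_periodic_mult[of "Suc n" j] by (simp add: m_def)
    assume "\<not> ?thesis"
    then have "\<epsilon> \<le> d (s (Suc n)) (s (Suc m))" by (simp add: m_def)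
    then have "\<phi> \<epsilon> \<le> \<phi> (d (s (Suc n)) (s (Suc m)))" using assms by (simp add: mono)
    also have "\<dots> \<le> \<phi> ?b"
    proof -
      have "0 \<le> \<psi> (d (s n) (s (Suc n))) (d (s m) (s (Suc m))) (d (s m) (s (Suc m)))"
        using psi by (simp add: psi_function_def d_s_nonneg)
      then show ?thesis using kannan_step(2)[OF m] by linarith
    qed
    also have "\<dots> \<le> \<phi> \<eta>"
    proof (rule mono[OF kannan_step(1)[OF m]])
      have "\<alpha> * d (s n) (s (Suc n)) \<le> 1 * d (s n) (s (Suc n))"
        "\<gamma> * d (s m) (s (Suc m)) \<le> 1 * d (s m) (s (Suc m))"
        by (rule mult_right_mono; use coeff d_s_nonneg in simp)+
      then show "?b \<le> \<eta>"
        using N[of n] N[of m] that by (simp add: m_def)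
    qed
    finally show False using \<eta> by simp
  qed
  then have "d (s n) (s (n + 1 + j * p)) < \<epsilon>" if "n \<ge> Suc N" for n j
    using that by (metis Suc_le_D Suc_le_mono)
  then show ?thesis by blast
qed

text \<open>The limit of the inequality for \<open>s n\<close> and \<open>u\<close> is
  \<open>\<phi> r \<le> \<phi> (\<gamma> * r) - \<psi> 0 r r\<close> with
  \<open>r = d u (T u)\<close>, and \<open>\<gamma> < 1\<close>.\<close>

lemma kannan_fixed_point: "\<exists>u. T u = u \<and> (\<forall>n. u \<in> B n)"
proof -
  obtain u where u: "(\<lambda>n. d (s n) u) \<longlonglongrightarrow> 0" "\<And>n. u \<in> B n"
    using orbit_limit[OF kannan_steps_tendsto_0 kannan_small] by blast
  have X: "u \<in> X" "T u \<in> X" using u(2) T_B B_sub by blast+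
  let ?r = "d u (T u)"
  have r: "0 \<le> ?r" using X by (simp add: d_nonneg)
  have ineq: "0 \<le> \<alpha> * d (s n) (s (Suc n)) + \<gamma> * ?r"
    "\<phi> (d (s (Suc n)) (T u)) \<le> \<phi> (\<alpha> * d (s n) (s (Suc n)) + \<gamma> * ?r)
        - \<psi> (d (s n) (s (Suc n))) ?r ?r" for n
    using kannan[OF s_B[of n] u(2)] by (simp_all add: T_s)
  have lim1: "(\<lambda>n. d (s (Suc n)) (T u)) \<longlonglongrightarrow> ?r"
    by (rule LIMSEQ_Suc[OF d_orbit_tendsto[OF u(1) X]])
  have lim2: "(\<lambda>n. \<alpha> * d (s n) (s (Suc n)) + \<gamma> * ?r) \<longlonglongrightarrow> \<alpha> * 0 + \<gamma> * ?r"
    by (intro tendsto_intros kannan_steps_tendsto_0)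
  have "\<gamma> * ?r \<le> 1 * ?r"
    by (rule mult_right_mono) (use coeff r in auto)
  then have "?r = 0"
    using altering_psi_limit[OF altering psi lim1 lim2 kannan_steps_tendsto_0 tendsto_const
        tendsto_const _ ineq(1) _ _ _ ineq(2)] X r
    by (simp add: d_nonneg)
  then show ?thesis using X u(2) d_eq_0_iff by metis
qed

text \<open>At fixed points every displacement is 0, so the right-hand side vanishes.\<close>

lemma kannan_unique:
  assumes "T u = u" "T v = v" "\<And>n. u \<in> B n" "\<And>n. v \<in> B n"
  shows "u = v"
proof -
  have X: "u \<in> X" "v \<in> X" using B_sub[OF assms(3)] B_sub[OF assms(4)] by auto
  have "\<phi> (d u v) \<le> \<phi> 0 - \<psi> 0 0 0"
    using kannan[OF assms(3)[of 0] assms(4)] assms X by (simp add: G1)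
  moreover have "\<phi> 0 = 0" "\<psi> 0 0 0 = 0" "\<phi> (d u v) \<ge> 0" "\<phi> (d u v) = 0 \<longleftrightarrow> d u v = 0"
    using altering psi d_nonneg[OF X]
    by (auto simp: altering_distance_def psi_function_def image_subset_iff)
  ultimately show ?thesis using d_eq_0_iff[OF X] by simp
qed

end

section \<open>Chatterjea type contractions\<close>

context
  fixes \<alpha> \<beta> :: real
  assumes coeff: "0 \<le> \<alpha>" "\<alpha> \<le> 1 / 2" "\<alpha> + \<beta> \<le> 1"
    and chatterjea: "\<And>n x y. x \<in> B n \<Longrightarrow> y \<in> B (Suc n) \<Longrightarrow>
        0 \<le> \<alpha> * d x (T y) + \<beta> * d (T x) y \<and>
        \<phi> (d (T x) (T y))
          \<le> \<phi> (\<alpha> * d x (T y) + \<beta> * d (T x) y) - \<psi> (d x (T y)) (d (T x) y) (d (T x) y)"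
begin

lemma chatterjea_step:
  assumes "s m \<in> B (Suc n)"
  shows "0 \<le> \<alpha> * d (s n) (s (Suc m)) + \<beta> * d (s (Suc n)) (s m)"
    and "\<phi> (d (s (Suc n)) (s (Suc m)))
      \<le> \<phi> (\<alpha> * d (s n) (s (Suc m)) + \<beta> * d (s (Suc n)) (s m))
        - \<psi> (d (s n) (s (Suc m))) (d (s (Suc n)) (s m)) (d (s (Suc n)) (s m))"
  using chatterjea[OF s_B[of n] assms] by (simp_all add: T_s)

text \<open>For consecutive points the \<beta> term is 0. With \<alpha> at most 1/2, the triangle
  inequality places \<open>\<alpha> * ?e n\<close> between the next step and the average of two
  consecutive steps.\<close>

lemma chatterjea_steps_tendsto_0: "(\<lambda>n. d (s n) (s (Suc n))) \<longlonglongrightarrow> 0"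
proof -
  let ?\<delta> = "\<lambda>n. d (s n) (s (Suc n))" and ?e = "\<lambda>n. d (s n) (s (Suc (Suc n)))"
  have step: "0 \<le> \<alpha> * ?e n" "\<phi> (?\<delta> (Suc n)) \<le> \<phi> (\<alpha> * ?e n) - \<psi> (?e n) 0 0" for n
    using chatterjea_step[OF s_B[of "Suc n"]] by (simp_all add: G1)
  have e_half: "\<alpha> * ?e n \<le> (?\<delta> n + ?\<delta> (Suc n)) / 2" for n
  proof -
    have "\<alpha> * ?e n \<le> 1 / 2 * ?e n"
      by (rule mult_right_mono) (use coeff d_s_nonneg in auto)
    then show ?thesis using d_triangle[of "s n" "s (Suc n)" "s (Suc (Suc n))"] by simp
  qed
  have le_e: "?\<delta> (Suc n) \<le> \<alpha> * ?e n" for n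
  proof (rule ccontr)
    assume "\<not> ?thesis"
    then have less: "\<alpha> * ?e n < ?\<delta> (Suc n)" by simp
    \<comment> \<open>A violation makes \<psi> vanish, hence \<open>?e n = 0\<close>; the inequality
      then reads \<open>\<phi> (?\<delta> (Suc n)) \<le> 0\<close>.\<close>
    then have "?e n = 0"
      using altering_psi_le[OF altering psi _ step(1) _ _ _ step(2)] by (simp add: d_s_nonneg)
    have "\<phi> (?\<delta> (Suc n)) \<le> 0"
    proof -
      have "\<phi> 0 = 0" "\<psi> 0 0 0 = 0"
        using altering psi by (auto simp: altering_distance_def psi_function_def)
      then show ?thesis using step(2)[of n] \<open>?e n = 0\<close> by simp
    qed
    then have "?\<delta> (Suc n) = 0"
      using altering d_s_nonneg[of "Suc n" "Suc (Suc n)"]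
      by (force simp: altering_distance_def image_subset_iff)
    then show False using less \<open>?e n = 0\<close> by simp
  qed
  have "?\<delta> (Suc n) \<le> ?\<delta> n" for n
    using le_e[of n] e_half[of n] by simp
  then obtain r where r: "?\<delta> \<longlonglongrightarrow> r"
    by (rule decreasing_steps_tendsto)
  then have r': "(\<lambda>n. ?\<delta> (Suc n)) \<longlonglongrightarrow> r"
    by (rule LIMSEQ_Suc)
  have "(\<lambda>n. (?\<delta> n + ?\<delta> (Suc n)) / 2) \<longlonglongrightarrow> (r + r) / 2"
    by (intro tendsto_intros r r') simp
  then have avg: "(\<lambda>n. (?\<delta> n + ?\<delta> (Suc n)) / 2) \<longlonglongrightarrow> r"
    by simp
  have lim: "(\<lambda>n. \<alpha> * ?e n) \<longlonglongrightarrow> r"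
    by (rule tendsto_sandwich[OF always_eventually always_eventually r' avg])
       (use le_e e_half in blast)+
  have "r = 0"
  \<comment> \<open>If \<alpha> is 0, the squeezed sequence is constantly 0. Otherwise
    \<open>?e\<close> has the limit \<open>r / \<alpha>\<close>, at which \<psi> must
    vanish.\<close>
  proof (cases "\<alpha> = 0")
    case True
    with lim show ?thesis by (simp add: LIMSEQ_const_iff)
  next
    case False
    then have "(\<lambda>n. ?e n) \<longlonglongrightarrow> r / \<alpha>"
      using tendsto_divide[OF lim tendsto_const[of \<alpha>]] by simp
    from altering_psi_limit[OF altering psi r' lim this tendsto_const tendsto_const _ step(1)
        _ _ _ step(2)]
    show ?thesis using False by (simp add: d_s_nonneg)
  qed
  with r show ?thesis by simp
qed

text \<open>Here the right-hand side contains far distances as well, so these are made to converge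
  to a common \<epsilon> along suitable pairs, and the limit of the inequality contradicts
  \<open>0 < \<epsilon>\<close>.\<close>

lemma chatterjea_small:
  assumes "0 < \<epsilon>"
  shows "\<exists>N. \<forall>n\<ge>N. \<forall>j. d (s n) (s (n + 1 + j * p)) < \<epsilon>"
proof (rule ccontr)
  let ?\<delta> = "\<lambda>n. d (s n) (s (Suc n))"
  let ?\<sigma> = "\<lambda>n. \<Sum>i<p. d (s (n + i)) (s (Suc (n + i)))"
  note steps = chatterjea_steps_tendsto_0
  assume "\<not> ?thesis"
  then have far: "\<exists>n\<ge>N. \<exists>j. \<epsilon> \<le> d (s n) (s (n + 1 + j * p))" for N
    by (meson not_less)
  \<comment> \<open>Beyond \<open>K\<close> the gap \<open>j = 0\<close> is not far, so the least
    far \<open>j\<close> has a predecessor.\<close>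
  have "\<forall>\<^sub>F n in sequentially. ?\<delta> n < \<epsilon>"
    by (rule order_tendstoD[OF steps]) (use assms in simp)
  then obtain K where K: "\<And>n. n \<ge> K \<Longrightarrow> ?\<delta> n < \<epsilon>"
    by (auto simp: eventually_sequentially)
  \<comment> \<open>The witness for \<open>l\<close> will be \<open>m - p\<close>, the last index
    before the distance from \<open>s n\<close> reaches \<epsilon>; the excess over \<epsilon> is at
    most the \<open>p\<close> steps after \<open>l\<close>.\<close>
  define Q where "Q k n m l \<longleftrightarrow> k \<le> n \<and> k \<le> m \<and> k \<le> l \<and> s m \<in> B (Suc n) \<and>
      \<epsilon> \<le> d (s n) (s m) \<and> d (s n) (s m) \<le> \<epsilon> + ?\<sigma> l" for k n m l
  have "\<exists>n m l. Q k n m l" for k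
  proof -
    obtain n where n: "n \<ge> k + K" and ex: "\<exists>j. \<epsilon> \<le> d (s n) (s (n + 1 + j * p))"
      using far by blast
    define j where "j = (LEAST j. \<epsilon> \<le> d (s n) (s (n + 1 + j * p)))"
    have j: "\<epsilon> \<le> d (s n) (s (n + 1 + j * p))"
      unfolding j_def using ex by (rule LeastI_ex)
    have "j \<noteq> 0"
      using j K[of n] n by (intro notI) simp
    then obtain i where i: "j = Suc i" by (cases j) auto
    have "d (s n) (s (n + 1 + i * p)) < \<epsilon>"
      using not_less_Least[of i "\<lambda>j. \<epsilon> \<le> d (s n) (s (n + 1 + j * p))"] i
      unfolding j_def by simp
    moreover define l where "l = n + 1 + i * p"
    ultimately have "d (s n) (s (l + p)) \<le> \<epsilon> + ?\<sigma> l"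
      using d_triangle[of "s n" "s l" "s (l + p)"] d_s_le_sum[of p l] by simp
    moreover have l_p: "l + p = n + 1 + j * p"
      by (simp add: l_def i)
    moreover have "s (l + p) \<in> B (Suc n)"
      using s_B[of "n + 1 + j * p"] B_periodic_mult[of "Suc n" j] by (simp add: l_p)
    moreover have "\<epsilon> \<le> d (s n) (s (l + p))" "k \<le> l"
      using j n by (simp_all add: l_p) (simp add: l_def)
    ultimately have "Q k n (l + p) l"
      using n unfolding Q_def by (intro conjI) (assumption | linarith)+
    then show ?thesis by blast
  qed
  then obtain n m l where "\<And>k. Q k (n k) (m k) (l k)"
    by metis
  then have nml: "k \<le> n k" "k \<le> m k" "k \<le> l k" "s (m k) \<in> B (Suc (n k))"
    "\<epsilon> \<le> d (s (n k)) (s (m k))" "d (s (n k)) (s (m k)) \<le> \<epsilon> + ?\<sigma> (l k)" for k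
    unfolding Q_def by blast+
  have at_top: "filterlim n sequentially sequentially" "filterlim m sequentially sequentially"
    "filterlim l sequentially sequentially"
    by (rule filterlim_at_top_mono[OF filterlim_ident]; simp add: nml)+
  have \<delta>: "(\<lambda>k. 2 * ?\<delta> (n k)) \<longlonglongrightarrow> 0" "(\<lambda>k. 2 * ?\<delta> (m k)) \<longlonglongrightarrow> 0"
    using filterlim_compose[OF steps at_top(1)] filterlim_compose[OF steps at_top(2)]
    by (auto intro: tendsto_mult_right_zero)
  have shift: "a \<longlonglongrightarrow> \<epsilon>"
    if "b \<longlonglongrightarrow> \<epsilon>" "c \<longlonglongrightarrow> 0" "\<And>k. \<bar>b k - a k\<bar> \<le> c k" for a b c :: "nat \<Rightarrow> real"
  proof -
    have "(\<lambda>k. b k - a k) \<longlonglongrightarrow> 0"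
      using that(2)
      by (rule tendsto_0_le[where K = 1])
         (use order_trans[OF that(3) abs_ge_self] in \<open>simp add: always_eventually\<close>)
    from tendsto_diff[OF that(1) this] show ?thesis by simp
  qed
  have "(\<lambda>k. \<epsilon> + ?\<sigma> (l k)) \<longlonglongrightarrow> \<epsilon> + 0"
    by (intro tendsto_intros filterlim_compose[OF sum_steps_tendsto_0[OF steps] at_top(3)])
  then have upper: "(\<lambda>k. \<epsilon> + ?\<sigma> (l k)) \<longlonglongrightarrow> \<epsilon>"
    by simp
  have nm: "(\<lambda>k. d (s (n k)) (s (m k))) \<longlonglongrightarrow> \<epsilon>"
    by (rule tendsto_sandwich[OF always_eventually always_eventually tendsto_const upper])
       (use nml in blast)+
  \<comment> \<open>Moving an index by one changes the distance by at most twice a step, so all four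
    distances share the limit \<epsilon>.\<close>
  have n_Sm: "(\<lambda>k. d (s (n k)) (s (Suc (m k)))) \<longlonglongrightarrow> \<epsilon>"
    by (rule shift[OF nm \<delta>(2)]) (simp add: d_diff_right)
  have Sn_m: "(\<lambda>k. d (s (Suc (n k))) (s (m k))) \<longlonglongrightarrow> \<epsilon>"
    by (rule shift[OF nm \<delta>(1)]) (simp add: d_diff_left)
  have Sn_Sm: "(\<lambda>k. d (s (Suc (n k))) (s (Suc (m k)))) \<longlonglongrightarrow> \<epsilon>"
    by (rule shift[OF n_Sm \<delta>(1)]) (simp add: d_diff_left)
  have lim: "(\<lambda>k. \<alpha> * d (s (n k)) (s (Suc (m k))) + \<beta> * d (s (Suc (n k))) (s (m k)))
      \<longlonglongrightarrow> \<alpha> * \<epsilon> + \<beta> * \<epsilon>"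
    by (intro tendsto_intros n_Sm Sn_m)
  have "\<alpha> * \<epsilon> + \<beta> * \<epsilon> \<le> \<epsilon>"
    using mult_right_mono[OF coeff(3), of \<epsilon>] assms by (simp add: algebra_simps)
  then have "\<epsilon> = 0"
    using altering_psi_limit[OF altering psi Sn_Sm lim n_Sm Sn_m Sn_m _
        chatterjea_step(1)[OF nml(4)] _ _ _ chatterjea_step(2)[OF nml(4)]]
    by (simp add: d_s_nonneg)
  with assms show False by simp
qed

text \<open>The limit of the inequality for \<open>s n\<close> and \<open>u\<close> is
  \<open>\<phi> r \<le> \<phi> (\<alpha> * r) - \<psi> r 0 0\<close> with
  \<open>r = d u (T u)\<close>.\<close>

lemma chatterjea_fixed_point: "\<exists>u. T u = u \<and> (\<forall>n. u \<in> B n)"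
proof -
  obtain u where u: "(\<lambda>n. d (s n) u) \<longlonglongrightarrow> 0" "\<And>n. u \<in> B n"
    using orbit_limit[OF chatterjea_steps_tendsto_0 chatterjea_small] by blast
  have X: "u \<in> X" "T u \<in> X" using u(2) T_B B_sub by blast+
  let ?r = "d u (T u)"
  have r: "0 \<le> ?r" using X by (simp add: d_nonneg)
  have ineq: "0 \<le> \<alpha> * d (s n) (T u) + \<beta> * d (s (Suc n)) u"
    "\<phi> (d (s (Suc n)) (T u)) \<le> \<phi> (\<alpha> * d (s n) (T u) + \<beta> * d (s (Suc n)) u)
        - \<psi> (d (s n) (T u)) (d (s (Suc n)) u) (d (s (Suc n)) u)" for n
    using chatterjea[OF s_B[of n] u(2), unfolded T_s] by blast+
  note lim = d_orbit_tendsto[OF u(1) X]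
  note lim0 = LIMSEQ_Suc[OF u(1)]
  have lim2: "(\<lambda>n. \<alpha> * d (s n) (T u) + \<beta> * d (s (Suc n)) u) \<longlonglongrightarrow> \<alpha> * ?r + \<beta> * 0"
    by (intro tendsto_intros lim lim0)
  have "\<alpha> * ?r \<le> 1 * ?r"
    by (rule mult_right_mono) (use coeff r in auto)
  then have "?r = 0"
    using altering_psi_limit[OF altering psi LIMSEQ_Suc[OF lim] lim2 lim lim0 lim0
        _ ineq(1) _ _ _ ineq(2)] X
    by (simp add: d_nonneg)
  then show ?thesis using X u(2) d_eq_0_iff by metis
qed

text \<open>At fixed points both distances on the right equal \<open>d u v\<close>, and their
  coefficients add up to at most 1.\<close>

lemma chatterjea_unique:
  assumes "T u = u" "T v = v" "\<And>n. u \<in> B n" "\<And>n. v \<in> B n"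
  shows "u = v"
proof -
  have X: "u \<in> X" "v \<in> X" using B_sub[OF assms(3)] B_sub[OF assms(4)] by auto
  have ineq: "0 \<le> \<alpha> * d u v + \<beta> * d u v"
    "\<phi> (d u v) \<le> \<phi> (\<alpha> * d u v + \<beta> * d u v) - \<psi> (d u v) (d u v) (d u v)"
    using chatterjea[OF assms(3)[of 0] assms(4)] assms by simp_all
  have "\<alpha> * d u v + \<beta> * d u v \<le> d u v"
    using mult_right_mono[OF coeff(3) d_nonneg[OF X]] by (simp add: algebra_simps)
  then have "d u v = 0"
    using altering_psi_le[OF altering psi _ ineq(1) _ _ _ ineq(2)] d_nonneg[OF X] by simp
  then show ?thesis using d_eq_0_iff[OF X] by simp
qed

end

end

section \<open>The fixed point theorem\<close>

theorem theorem2p2: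
  fixes X :: "'a set" and G :: "'a \<Rightarrow> 'a \<Rightarrow> 'a \<Rightarrow> real"
    and p :: nat and A :: "nat \<Rightarrow> 'a set" and T :: "'a \<Rightarrow> 'a"
    and \<phi> :: "real \<Rightarrow> real" and \<psi> :: "real \<Rightarrow> real \<Rightarrow> real \<Rightarrow> real"
  assumes "G_metric_space X G" and "G_complete X G"
    and "p \<ge> 1"
    and "\<And>i. i \<in> {1..p} \<Longrightarrow> A i \<noteq> {} \<and> G_closed X G (A i)"
    and "cyclical_operator p A T"
    and "altering_distance \<phi>" and "psi_function \<psi>"
    and "G_cyclic_Kannan G p A \<phi> \<psi> T \<or> G_cyclic_Chatterjea G p A \<phi> \<psi> T"
  shows "(\<exists>!u. u \<in> (\<Union>i\<in>{1..p}. A i) \<and> T u = u) \<and>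
         (\<forall>u\<in>(\<Union>i\<in>{1..p}. A i). T u = u \<longrightarrow> u \<in> (\<Inter>i\<in>{1..p}. A i))"
proof -
  \<comment> \<open>Indices are shifted so that \<open>B 0\<close> is \<open>A 1\<close>.\<close>
  define B where "B n = A (n mod p + 1)" for n
  have idx: "n mod p + 1 \<in> {1..p}" for n
    using \<open>p \<ge> 1\<close> by (simp add: Suc_leI)
  \<comment> \<open>At the wrap-around \<open>n mod p + 1 = p\<close> this is the convention
    \<open>A (p + 1) = A 1\<close>.\<close>
  have B_Suc: "B (Suc n) = A (n mod p + 1 + 1)" for n
    using \<open>p \<ge> 1\<close> \<open>cyclical_operator p A T\<close>
    by (auto simp: B_def mod_Suc cyclical_operator_def)
  have A_B: "A i = B (i - 1)" if "i \<in> {1..p}" for i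
    using that by (auto simp: B_def)
  have T_B: "T x \<in> B (Suc n)" if "x \<in> B n" for x n
  proof -
    have "\<forall>i\<in>{1..p}. T ` A i \<subseteq> A (i + 1)"
      using \<open>cyclical_operator p A T\<close> by (simp add: cyclical_operator_def)
    then have "T ` A (n mod p + 1) \<subseteq> A (n mod p + 1 + 1)"
      using idx by (rule bspec)
    with that show ?thesis
      unfolding B_Suc unfolding B_def by (rule subsetD[OF _ imageI, rotated])
  qed
  obtain x\<^sub>0 where "x\<^sub>0 \<in> B 0"
    using assms(4)[OF idx[of 0]] by (auto simp: B_def)
  interpret cyclic_orbit X G p B T x\<^sub>0 \<phi> \<psi>
  proof (intro cyclic_orbit.intro cyclic_orbit_axioms.intro assms)
    show "G_closed X G (B n)" for n
      using assms(4)[OF idx[of n]] by (simp add: B_def)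
  qed (use \<open>p \<ge> 1\<close> T_B \<open>x\<^sub>0 \<in> B 0\<close> in \<open>auto simp: B_def\<close>)
  have fixed_in_all: "u \<in> B n" if "u \<in> (\<Union>i\<in>{1..p}. A i)" "T u = u" for u n
  proof -
    obtain m where "u \<in> B m" using \<open>u \<in> _\<close> A_B by auto
    then have up: "u \<in> B (m + k)" for k
      using T_B[of u] \<open>T u = u\<close> by (induction k) auto
    \<comment> \<open>A fixed point stays in all later sets; going on to index
      \<open>n + m * p\<close> reaches \<open>B n\<close> without stepping backwards.\<close>
    have "m + (n + m * (p - 1)) = n + m * p"
      using \<open>p \<ge> 1\<close> by (cases p) auto
    then show ?thesis
      using up[of "n + m * (p - 1)"] B_periodic_mult[of n m] by (simp only:)
  qed
  have "(\<exists>u. T u = u \<and> (\<forall>n. u \<in> B n)) \<and>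
      (\<forall>u v. T u = u \<longrightarrow> T v = v \<longrightarrow> (\<forall>n. u \<in> B n) \<longrightarrow> (\<forall>n. v \<in> B n) \<longrightarrow> u = v)"
    using assms(8)
  proof
    assume "G_cyclic_Kannan G p A \<phi> \<psi> T"
    then obtain \<alpha> \<beta> where coeff: "0 \<le> 2 * \<beta>" "2 * \<beta> < 1" "\<alpha> + 2 * \<beta> \<le> 1"
      and ineq: "\<And>i x y z. i \<in> {1..p} \<Longrightarrow> x \<in> A i \<Longrightarrow> y \<in> A (i + 1) \<Longrightarrow> z \<in> A (i + 1) \<Longrightarrow>
          0 \<le> \<alpha> * G x (T x) (T x) + \<beta> * (G y (T y) (T y) + G z (T z) (T z)) \<and>
          \<phi> (G (T x) (T y) (T z))
            \<le> \<phi> (\<alpha> * G x (T x) (T x) + \<beta> * (G y (T y) (T y) + G z (T z) (T z)))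
              - \<psi> (G x (T x) (T x)) (G y (T y) (T y)) (G z (T z) (T z))"
      unfolding G_cyclic_Kannan_def by blast
    \<comment> \<open>Taking \<open>z = y\<close> merges the two \<beta> terms into one with
      coefficient \<gamma>.\<close>
    have contr: "0 \<le> \<alpha> * d x (T x) + 2 * \<beta> * d y (T y) \<and>
        \<phi> (d (T x) (T y)) \<le> \<phi> (\<alpha> * d x (T x) + 2 * \<beta> * d y (T y))
          - \<psi> (d x (T x)) (d y (T y)) (d y (T y))"
      if "x \<in> B n" "y \<in> B (Suc n)" for n x y
      using ineq[OF idx[of n], of x y y] that unfolding B_Suc by (simp add: B_def algebra_simps)
    have "\<exists>u. T u = u \<and> (\<forall>n. u \<in> B n)"
      by (rule kannan_fixed_point[OF coeff]) (rule contr)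
    moreover have "u = v"
      if "T u = u" "T v = v" "\<And>n. u \<in> B n" "\<And>n. v \<in> B n" for u v
      by (rule kannan_unique[OF coeff _ that]) (rule contr)
    ultimately show ?thesis by blast
  next
    assume "G_cyclic_Chatterjea G p A \<phi> \<psi> T"
    then obtain \<alpha> \<beta> where coeff: "0 \<le> \<alpha>" "\<alpha> \<le> 1 / 2" "\<alpha> + \<beta> \<le> 1"
      and ineq: "\<And>i x y z. i \<in> {1..p} \<Longrightarrow> x \<in> A i \<Longrightarrow> y \<in> A (i + 1) \<Longrightarrow> z \<in> A (i + 1) \<Longrightarrow>
          0 \<le> \<alpha> * G x (T y) (T z) + \<beta> * G y z (T x) \<and>
          \<phi> (G (T x) (T y) (T z))
            \<le> \<phi> (\<alpha> * G x (T y) (T z) + \<beta> * G y z (T x))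
              - \<psi> (G x (T y) (T z)) (G y z (T x)) (G z y (T x))"
      unfolding G_cyclic_Chatterjea_def by blast
    have contr: "0 \<le> \<alpha> * d x (T y) + \<beta> * d (T x) y \<and>
        \<phi> (d (T x) (T y)) \<le> \<phi> (\<alpha> * d x (T y) + \<beta> * d (T x) y)
          - \<psi> (d x (T y)) (d (T x) y) (d (T x) y)"
      if "x \<in> B n" "y \<in> B (Suc n)" for n x y
    proof -
      \<comment> \<open>With \<open>z = y\<close> the last two arguments of \<psi> coincide, and
        symmetry turns them into a value of \<open>d\<close>.\<close>
      have "G y y (T x) = d (T x) y"
        using that T_B B_sub by (blast intro: G_diag_left)
      then show ?thesis
        using ineq[OF idx[of n], of x y y] that unfolding B_Suc by (simp add: B_def)
    qed
    have "\<exists>u. T u = u \<and> (\<forall>n. u \<in> B n)"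
      by (rule chatterjea_fixed_point[OF coeff]) (rule contr)
    moreover have "u = v"
      if "T u = u" "T v = v" "\<And>n. u \<in> B n" "\<And>n. v \<in> B n" for u v
      by (rule chatterjea_unique[OF coeff _ that]) (rule contr)
    ultimately show ?thesis by blast
  qed
  then obtain u where u: "T u = u" "\<And>n. u \<in> B n"
    and unique: "\<And>v. T v = v \<Longrightarrow> (\<And>n. v \<in> B n) \<Longrightarrow> v = u"
    by blast
  have "u \<in> (\<Union>i\<in>{1..p}. A i)"
    using u(2)[of 0] idx[of 0] unfolding B_def by blast
  then have "\<exists>!u. u \<in> (\<Union>i\<in>{1..p}. A i) \<and> T u = u"
    using u(1) unique fixed_in_all by blast
  moreover have "\<forall>u\<in>(\<Union>i\<in>{1..p}. A i). T u = u \<longrightarrow> u \<in> (\<Inter>i\<in>{1..p}. A i)"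
    using fixed_in_all A_B by blast
  ultimately show ?thesis ..
qed

end
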